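(* Let $\mu_q$ be a Gaussian measure $\mathcal{N}(q_*,\Sigma_{qq})$ on $X=\mathbb{R}^3$ (so $\mu_q(X)=1$). For $m\in Y$ let $\mu_m$ be the approximate posterior measure on $X$, which is absolutely continuous with respect to $\mu_q$ and given by $$\frac{\mathrm{d}\mu_m}{\mathrm{d}\mu_q}(q)=\frac{1}{L(m)}\exp(-G(q;m)),\qquad L(m)=\int_X \exp(-G(q;m))\,\mathrm{d}\mu_q(q),$$ where $$G(q;m)=\frac12\,\big(m-\mathcal{F}(q)-w_{*|q}\big)^{\top}\Sigma_{w|q}^{-1}\big(m-\mathcal{F}(q)-w_{*|q}\big).$$ Then for every $r>0$ there exists $M=M(r)>0$ such that for all $m_1,m_2\in Y$ with $\max\{\|m_1\|_Y,\|m_2\|_Y\}\le r$, $$d_{\rm Hell}(\mu_{m_1},\mu_{m_2})\le M\,\|m_1-m_2\|_Y .$$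
   Context: Physical setting. $\Omega\subset\mathbb{R}^3$ is a simply connected bounded domain, $c>0$ is a constant (wave speed), $d_\Omega=\sup_{x,y\in\Omega}\|x-y\|$, and $T>2d_\Omega/c$. The function $\lambda:\mathbb{R}\to\mathbb{R}$ satisfies $\lambda(t)=0$ for $t<0$, $\lambda\in\mathcal{C}^1[0,T]$, and $\lambda$ is periodic on $[0,T]$ with period $p>0$, where $T=Jp$ with $J$ a positive integer. $D\subset\mathbb{R}^3$ is a bounded domain with $\Omega\subset D$, and $\Gamma\subset\mathbb{R}^3\setminus\overline{D}$ is a measurement surface. Fix $j\in\{1,\dots,J\}$ and $T_j=((j-1)p,jp]$. Measurements are taken at finitely many points $x_1,\dots,x_{N_x}\in\Gamma$ and finitely many times $t^1,\dots,t^{N_p}\in T_j$. Spaces. $X=\mathbb{R}^3$ with the Euclidean norm (the unknown $q\in X$ is a point source position). $Y=\mathbb{R}^{N_x\times N_p}$ with the Frobenius norm $\|A\|_Y=(\sum|a_{ij}|^2)^{1/2}$; in matrix products with covariance matrices, elements of $Y$ are identified with vectors in $\mathbb{R}^{N_xN_p}$. Forward operator. $\mathcal{F}(q)\in Y$ is the array with entries $$\frac{\lambda(t^n-c^{-1}\|x_l-q\|)}{4\pi\|x_l-q\|},\qquad l=1,\dots,N_x,\ n=1,\dots,N_p,$$ which is defined for all $q\notin\{x_1,\dots,x_{N_x}\}$ (hence $\mu_q$-almost everywhere). Error model. The additive noise is $e\sim\mathcal{N}(e_*,\Sigma_{ee})$ on $Y$ with $e_*=0$. The pair $(\zeta,q)$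 of approximation error $\zeta\in Y$ and unknown $q$ is modelled as jointly Gaussian with mean $(\zeta_*,q_* )$ and invertible covariance matrix $\begin{pmatrix}\Sigma_{\zeta\zeta}&\Sigma_{\zeta q}\\ \Sigma_{q\zeta}&\Sigma_{qq}\end{pmatrix}$. Set $$w_{*|q}=e_*+\zeta_*+\Sigma_{\zeta q}\Sigma_{qq}^{-1}(q-q_* ),\qquad \Sigma_{w|q}=\Sigma_{ee}+\Sigma_{\zeta\zeta}-\Sigma_{\zeta q}\Sigma_{qq}^{-1}\Sigma_{q\zeta}.$$ All these means and covariances are fixed (independent of $m$). Hellinger distance. For probability measures $\mu_1,\mu_2$ with common reference measure $\nu$, $$d_{\rm Hell}(\mu_1,\mu_2)=\left(\int\left(\sqrt{\mathrm{d}\mu_1/\mathrm{d}\nu}-\sqrt{\mathrm{d}\mu_2/\mathrm{d}\nu}\right)^2\mathrm{d}\nu\right)^{1/2}.$$ *)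

theory Defs
  imports "HOL-Probability.Probability"
begin

text \<open>
  An array with rows indexed by 'l and columns indexed by 'n is represented as a vector of type
  real^('l \<times> 'n): its Euclidean norm is the Frobenius norm of the array, and a covariance
  matrix of a random array is an ordinary square matrix over the index type 'l \<times> 'n.
\<close>

definition C1_on_Icc :: "(real \<Rightarrow> real) \<Rightarrow> real \<Rightarrow> real \<Rightarrow> bool" where
  "C1_on_Icc f a b \<longleftrightarrow>
     (\<exists>g. (\<forall>t\<in>{a..b}. (f has_real_derivative g t) (at t within {a..b})) \<and> continuous_on {a..b} g)"

definition periodic_on_Icc :: "(real \<Rightarrow> real) \<Rightarrow> real \<Rightarrow> real \<Rightarrow> real \<Rightarrow> bool" where
  "periodic_on_Icc f a b p \<longleftrightarrow> (\<forall>t. a \<le> t \<and> t + p \<le> b \<longrightarrow> f (t + p) = f t)"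

definition bounded_domain :: "(real^3) set \<Rightarrow> bool" where
  "bounded_domain S \<longleftrightarrow> open S \<and> connected S \<and> S \<noteq> {} \<and> bounded S"

definition vec_join :: "real^'a \<Rightarrow> real^'b \<Rightarrow> real^('a + 'b)" where
  "vec_join u v = (\<chi> i. case i of Inl a \<Rightarrow> u $ a | Inr b \<Rightarrow> v $ b)"

definition block_matrix ::
    "real^'a^'a \<Rightarrow> real^'b^'a \<Rightarrow> real^'a^'b \<Rightarrow> real^'b^'b \<Rightarrow> real^('a + 'b)^('a + 'b)" where
  "block_matrix A B C D =
     (\<chi> i. case i of Inl a \<Rightarrow> vec_join (A $ a) (B $ a) | Inr b \<Rightarrow> vec_join (C $ b) (D $ b))"

text \<open>
  A Borel probability measure is Gaussian with mean a and covariance matrix S if every linear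
  functional u has the law N(u \<bullet> a, u \<bullet> S u) under it, where N(b, 0) is the Dirac measure at b.
  This covers singular S. Symmetry of S has to be required separately, since
  the one-dimensional laws only determine the symmetric part of S.
\<close>

definition gaussian_measure :: "(real^'k) measure \<Rightarrow> real^'k \<Rightarrow> real^'k^'k \<Rightarrow> bool" where
  "gaussian_measure \<mu> a S \<longleftrightarrow>
     prob_space \<mu> \<and> sets \<mu> = sets borel \<and> transpose S = S \<and>
     (\<forall>u. 0 \<le> u \<bullet> (S *v u) \<and>
          distr \<mu> borel (\<lambda>x. u \<bullet> x) =
            (if u \<bullet> (S *v u) = 0 then return borel (u \<bullet> a)
             else density lborel (\<lambda>s. ennreal (normal_density (u \<bullet> a) (sqrt (u \<bullet> (S *v u))) s))))"

definition gaussian_rv :: "'w measure \<Rightarrow> ('w \<Rightarrow> real^'k) \<Rightarrow> real^'k \<Rightarrow> real^'k^'k \<Rightarrow> bool" where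
  "gaussian_rv P X a S \<longleftrightarrow> X \<in> borel_measurable P \<and> gaussian_measure (distr P borel X) a S"

text \<open>At the receiver positions q = x l, division by zero gives the entry the value 0.\<close>

definition forward ::
    "(real \<Rightarrow> real) \<Rightarrow> real \<Rightarrow> ('l::finite \<Rightarrow> real^3) \<Rightarrow> ('n::finite \<Rightarrow> real) \<Rightarrow> real^3 \<Rightarrow> real^('l \<times> 'n)" where
  "forward lam c x t q =
     (\<chi> i. lam (t (snd i) - norm (x (fst i) - q) / c) / (4 * pi * norm (x (fst i) - q)))"

definition cond_mean ::
    "real^'k \<Rightarrow> real^'k \<Rightarrow> real^3 \<Rightarrow> real^3^'k \<Rightarrow> real^3^3 \<Rightarrow> real^3 \<Rightarrow> real^'k" where
  "cond_mean es zs qs Szq Sqq q = es + zs + (Szq ** matrix_inv Sqq) *v (q - qs)"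

definition cond_cov ::
    "real^'k^'k \<Rightarrow> real^'k^'k \<Rightarrow> real^3^'k \<Rightarrow> real^'k^3 \<Rightarrow> real^3^3 \<Rightarrow> real^'k^'k" where
  "cond_cov See Szz Szq Sqz Sqq = See + Szz - Szq ** matrix_inv Sqq ** Sqz"

definition potential ::
    "(real^3 \<Rightarrow> real^'k) \<Rightarrow> (real^3 \<Rightarrow> real^'k) \<Rightarrow> real^'k^'k \<Rightarrow> real^3 \<Rightarrow> real^'k \<Rightarrow> real" where
  "potential F w S q m = 1/2 * ((m - F q - w q) \<bullet> (matrix_inv S *v (m - F q - w q)))"

definition evidence :: "(real^3) measure \<Rightarrow> (real^3 \<Rightarrow> real^'k \<Rightarrow> real) \<Rightarrow> real^'k \<Rightarrow> real" where
  "evidence \<mu>q G m = (\<integral>q. exp (- G q m) \<partial>\<mu>q)"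

definition posterior ::
    "(real^3) measure \<Rightarrow> (real^3 \<Rightarrow> real^'k \<Rightarrow> real) \<Rightarrow> real^'k \<Rightarrow> (real^3) measure" where
  "posterior \<mu>q G m = density \<mu>q (\<lambda>q. ennreal (1 / evidence \<mu>q G m * exp (- G q m)))"

definition hellinger :: "'a measure \<Rightarrow> 'a measure \<Rightarrow> 'a measure \<Rightarrow> real" where
  "hellinger \<nu> \<mu>1 \<mu>2 =
     sqrt (\<integral>x. (sqrt (enn2real (RN_deriv \<nu> \<mu>1 x)) - sqrt (enn2real (RN_deriv \<nu> \<mu>2 x)))\<^sup>2 \<partial>\<nu>)"

end

theory Submission
  imports Defs
begin

text \<open>
The difficulty is that \<open>\<F> q\<close> may be unbounded as \<open>q\<close> approaches a receiver, so the potential need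
not be locally Lipschitz in the data uniformly in \<open>q\<close>. The likelihood is: it is Gaussian in the residual,
and so damps large residuals by itself.

Write \<open>A\<close> for the inverse of the conditional covariance and \<open>|v|\<^sub>A = sqrt (v \<bullet> A v)\<close>. The block
covariance of \<open>(\<zeta>, q)\<close> is invertible, so its Schur complement is positive definite; adding the
noise covariance preserves this, hence \<open>A\<close> exists, is positive semidefinite, and \<open>|\<cdot>|\<^sub>A\<close> is a
seminorm with \<open>|v|\<^sub>A \<le> C \<parallel>v\<parallel>\<close> (lemmas \<open>psd_inverse_cond_cov\<close>, \<open>wnorm_triangle\<close>, \<open>wnorm_le_norm\<close>).

The square root of the unnormalised posterior density is
\<open>g m q = exp (- |m - \<F> q - w q|\<^sub>A\<^sup>2 / 4)\<close>. As \<open>s \<mapsto> exp (- s\<^sup>2 / 4)\<close> is 1-Lipschitz on the whole line,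
\<open>g\<close> is bounded by 1 and \<open>C\<close>-Lipschitz in \<open>m\<close>, with constants that do not depend on \<open>q\<close>, however
large \<open>\<F> q\<close> is (lemma \<open>exp_neg_quarter_square_Lipschitz\<close>). Integrating \<open>g\<^sup>2\<close> shows that
the evidence \<open>L\<close> is \<open>2 C\<close>-Lipschitz. On the ball of radius \<open>r\<close> the evidence is at least \<open>d > 0\<close>, namely the integral of the everywhere positive function
\<open>exp (- (C r + |\<F> q + w q|\<^sub>A)\<^sup>2 / 2)\<close>. Therefore the square roots \<open>g m q / sqrt (L m)\<close> of the
normalised densities are Lipschitz in \<open>m\<close> on that ball, uniformly in \<open>q\<close>, and integrating the
square of this pointwise estimate against the prior, a probability measure, gives the claim (lemmas
\<open>hellinger_density_le\<close> and \<open>hellinger_posterior_Lipschitz\<close>).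

Measurability of \<open>\<F>\<close> uses that measurement times do not exceed \<open>T\<close>: all retarded times then lie in
the half-line up to \<open>T\<close>, where the source signal is zero at negative times and continuous on
\<open>[0, T]\<close> (lemma \<open>borel_measurable_forward\<close>).
\<close>

section \<open>Positive semidefinite matrices and their seminorms\<close>

definition psd :: "real^'k^'k \<Rightarrow> bool" where
  "psd A \<longleftrightarrow> transpose A = A \<and> (\<forall>u. 0 \<le> u \<bullet> (A *v u))"

text \<open>
  For \<open>A\<close> the inverse of a covariance matrix, this is the Mahalanobis norm of a residual.
\<close>

definition wnorm :: "real^'k^'k \<Rightarrow> real^'k \<Rightarrow> real" where
  "wnorm A v = sqrt (v \<bullet> (A *v v))"

lemma inner_transpose_mult:
  fixes A :: "real^'m^'n"
  shows "u \<bullet> (transpose A *v v) = (A *v u) \<bullet> v"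
  by (metis dot_lmul_matrix inner_commute transpose_matrix_vector)

lemma matrix_vector_mult_minus:
  fixes A :: "real^'m^'n"
  shows "A *v (- v) = - (A *v v)"
  using matrix_vector_mult_scaleR[of A "-1" v] by simp

lemma psd_inner_swap:
  assumes "psd A"
  shows "u \<bullet> (A *v v) = v \<bullet> (A *v u)"
  using assms inner_transpose_mult[of u A v] by (simp add: psd_def inner_commute)

text \<open>
  The quadratic \<open>s \<mapsto> (u + s v) \<bullet> A (u + s v)\<close> is nonnegative, so its discriminant is not positive.
  The form may be degenerate, in which case the quadratic is affine and must be constant.
\<close>

lemma psd_Cauchy_Schwarz:
  assumes "psd A"
  shows "(u \<bullet> (A *v v))\<^sup>2 \<le> (u \<bullet> (A *v u)) * (v \<bullet> (A *v v))"
proof -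
  define a b d where "a = u \<bullet> (A *v u)" and "b = u \<bullet> (A *v v)" and "d = v \<bullet> (A *v v)"
  have quad: "0 \<le> a + 2 * s * b + s\<^sup>2 * d" for s
  proof -
    have "0 \<le> (u + s *\<^sub>R v) \<bullet> (A *v (u + s *\<^sub>R v))"
      using assms by (simp add: psd_def)
    also have "\<dots> = a + 2 * s * b + s\<^sup>2 * d"
      using psd_inner_swap[OF assms, of v u]
      by (simp add: a_def b_def d_def power2_eq_square algebra_simps)
    finally show ?thesis .
  qed
  have "b\<^sup>2 \<le> a * d"
  proof (cases "d = 0")
    case True
    have "b = 0"
    proof (rule ccontr)
      assume "b \<noteq> 0"
      then show False
        \<comment> \<open>at this \<open>s\<close> the affine function has the value \<open>-1\<close>\<close>
        using quad[of "- (a + 1) / (2 * b)"] True by (simp add: field_simps)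
    qed
    with True show ?thesis by simp
  next
    case False
    then have "d > 0" using assms by (metis d_def less_eq_real_def psd_def)
    \<comment> \<open>\<open>s = - b / d\<close> minimises the quadratic\<close>
    have "0 \<le> a - b\<^sup>2 / d"
      using quad[of "- b / d"] False by (simp add: field_simps power2_eq_square)
    then show ?thesis using \<open>d > 0\<close> by (simp add: field_simps)
  qed
  then show ?thesis by (simp add: a_def b_def d_def)
qed

text \<open>
  Isotropic vectors of a semidefinite form lie in its radical: Cauchy--Schwarz bounds the pairing
  of \<open>u\<close> with \<open>A u\<close>, which is the squared length of \<open>A u\<close>. This is what turns an invertible
  semidefinite matrix into a definite one.
\<close>

lemma psd_kernel:
  assumes "psd A" "u \<bullet> (A *v u) = 0"
  shows "A *v u = 0"
  using psd_Cauchy_Schwarz[OF assms(1), of "A *v u" u] assms(2) by simp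

lemma wnorm_nonneg [simp]: "psd A \<Longrightarrow> 0 \<le> wnorm A v"
  by (simp add: wnorm_def psd_def)

lemma wnorm_squared: "psd A \<Longrightarrow> (wnorm A v)\<^sup>2 = v \<bullet> (A *v v)"
  by (simp add: wnorm_def psd_def)

lemma wnorm_minus [simp]: "wnorm A (- v) = wnorm A v"
  by (simp add: wnorm_def matrix_vector_mult_minus)

lemma wnorm_triangle:
  assumes "psd A"
  shows "wnorm A (u + v) \<le> wnorm A u + wnorm A v"
proof -
  have "\<bar>u \<bullet> (A *v v)\<bar> \<le> wnorm A u * wnorm A v"
  proof (rule power2_le_imp_le)
    show "\<bar>u \<bullet> (A *v v)\<bar>\<^sup>2 \<le> (wnorm A u * wnorm A v)\<^sup>2"
      using psd_Cauchy_Schwarz[OF assms, of u v] assms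
      by (simp add: power_mult_distrib wnorm_squared)
  qed (use assms in simp)
  then have "(wnorm A (u + v))\<^sup>2 \<le> (wnorm A u + wnorm A v)\<^sup>2"
    using psd_inner_swap[OF assms, of v u] assms
    by (simp add: wnorm_squared power2_sum matrix_vector_right_distrib inner_add_left inner_add_right)
  then show ?thesis
    using assms by (meson add_nonneg_nonneg power2_le_imp_le wnorm_nonneg)
qed

lemma wnorm_diff_le: "psd A \<Longrightarrow> wnorm A (u - v) \<le> wnorm A u + wnorm A v"
  using wnorm_triangle[of A u "- v"] by simp

lemma wnorm_reverse_triangle:
  assumes "psd A"
  shows "\<bar>wnorm A u - wnorm A v\<bar> \<le> wnorm A (u - v)"
  using wnorm_triangle[OF assms, of "u - v" v] wnorm_triangle[OF assms, of "v - u" u]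
    wnorm_minus[of A "u - v"] by simp

lemma wnorm_le_norm:
  obtains K where "K > 0" "\<And>v. wnorm A v \<le> K * norm v"
proof -
  obtain B where "B > 0" and B: "\<And>v. norm (A *v v) \<le> norm v * B"
    using bounded_linear.pos_bounded[OF matrix_vector_mul_bounded_linear[of A]] by blast
  have "wnorm A v \<le> sqrt B * norm v" for v
  proof -
    have "v \<bullet> (A *v v) \<le> norm v * norm (A *v v)" by (rule norm_cauchy_schwarz)
    also have "\<dots> \<le> norm v * (norm v * B)" by (intro mult_left_mono B) auto
    finally have "wnorm A v \<le> sqrt (B * (norm v)\<^sup>2)"
      unfolding wnorm_def by (intro real_sqrt_le_mono) (simp add: power2_eq_square mult_ac)
    then show ?thesis by (simp add: real_sqrt_mult)
  qed
  with \<open>B > 0\<close> show ?thesis using that[of "sqrt B"] by simp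
qed

section \<open>The conditional covariance\<close>

lemma matrix_inv_inverse:
  assumes "invertible A"
  shows "A ** matrix_inv A = mat 1" "matrix_inv A ** A = mat 1"
  using someI_ex[OF assms[unfolded invertible_def]] by (auto simp: matrix_inv_def)

lemma invertible_if_trivial_kernel:
  fixes A :: "real^'k^'k"
  assumes "\<And>u. A *v u = 0 \<Longrightarrow> u = 0"
  shows "invertible A"
  using assms by (simp add: invertible_left_inverse matrix_left_invertible_ker)

text \<open>Substituting \<open>u = A w\<close> turns the form of the inverse into the form of \<open>A\<close>.\<close>

lemma psd_matrix_inv:
  assumes "psd A" "invertible A"
  shows "psd (matrix_inv A)"
proof -
  note inv = matrix_inv_inverse[OF assms(2)]
  have sym: "transpose A = A" using assms(1) by (simp add: psd_def)
  have "transpose (matrix_inv A) ** A = mat 1"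
    using inv(1) by (metis sym matrix_transpose_mul transpose_mat)
  then have "transpose (matrix_inv A) = matrix_inv A"
    by (metis inv(1) matrix_mul_assoc matrix_mul_lid matrix_mul_rid)
  moreover have "0 \<le> u \<bullet> (matrix_inv A *v u)" for u
  proof -
    have "u = A *v (matrix_inv A *v u)"
      by (simp add: matrix_vector_mul_assoc inv)
    then have "u \<bullet> (matrix_inv A *v u) = (matrix_inv A *v u) \<bullet> (A *v (matrix_inv A *v u))"
      by (metis inner_commute)
    then show ?thesis using assms(1) by (simp add: psd_def)
  qed
  ultimately show ?thesis by (simp add: psd_def)
qed

lemma sum_over_sum_type:
  "(\<Sum>i\<in>(UNIV::('a::finite + 'b::finite) set). f i) = (\<Sum>a\<in>UNIV. f (Inl a)) + (\<Sum>b\<in>UNIV. f (Inr b))"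
  using sum.Plus[of UNIV UNIV f] by simp

lemma vec_join_inner: "vec_join u v \<bullet> vec_join u' v' = u \<bullet> u' + v \<bullet> v'"
  by (simp add: inner_vec_def vec_join_def sum_over_sum_type)

lemma vec_join_eq_0_iff: "vec_join u v = 0 \<longleftrightarrow> u = 0 \<and> v = 0"
  using vec_join_inner[of u v u v]
  by (metis add_nonneg_eq_0_iff inner_eq_zero_iff inner_ge_zero)

lemma block_matrix_mult_vec_join:
  "block_matrix A B C D *v vec_join u v = vec_join (A *v u + B *v v) (C *v u + D *v v)"
  by (auto simp: vec_eq_iff block_matrix_def vec_join_def matrix_vector_mult_def sum_over_sum_type
      split: sum.splits)

lemma block_matrix_symmetricD:
  assumes "transpose (block_matrix A B C D) = block_matrix A B C D"
  shows "transpose A = A" "transpose D = D" "transpose B = C" "transpose C = B"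
proof -
  have eq: "block_matrix A B C D $ i $ j = block_matrix A B C D $ j $ i" for i j
    by (subst (2) assms[symmetric]) (simp add: transpose_def)
  show "transpose A = A"
    using eq[of "Inl _" "Inl _"] by (simp add: vec_eq_iff transpose_def block_matrix_def vec_join_def)
  show "transpose D = D"
    using eq[of "Inr _" "Inr _"] by (simp add: vec_eq_iff transpose_def block_matrix_def vec_join_def)
  show "transpose B = C"
    using eq[of "Inl _" "Inr _"] by (simp add: vec_eq_iff transpose_def block_matrix_def vec_join_def)
  then show "transpose C = B" by auto
qed

text \<open>
  Completing the square: for fixed first component \<open>u\<close>, the block form is minimised over the second
  component at \<open>v = - D\<^sup>-\<^sup>1 C u\<close>, and its minimum is the form of the Schur complement at \<open>u\<close>. At the
  minimiser the second block of the image vanishes. Definiteness of the block matrix, which follows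
  from invertibility by \<open>psd_kernel\<close>, thus passes to the Schur complement, and also to \<open>D\<close>, so that
  \<open>D\<^sup>-\<^sup>1\<close> makes sense.
\<close>

lemma Schur_complement_pos_def:
  fixes A :: "real^'a^'a" and D :: "real^'b^'b"
  assumes psd: "psd (block_matrix A B C D)" and inv: "invertible (block_matrix A B C D)"
  defines "W \<equiv> A - B ** matrix_inv D ** C"
  shows "psd W" and "u \<bullet> (W *v u) = 0 \<Longrightarrow> u = 0"
proof -
  let ?M = "block_matrix A B C D"
  have kernel: "z = 0" if "z \<bullet> (?M *v z) = 0" for z
    using psd_kernel[OF psd that] inv
    by (metis matrix_inv_inverse(2) matrix_vector_mul_assoc matrix_vector_mul_lid matrix_vector_mult_0_right)
  have "transpose ?M = ?M" using psd by (simp add: psd_def)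
  note sym = block_matrix_symmetricD[OF this]
  have D_form: "vec_join 0 v \<bullet> (?M *v vec_join 0 v) = v \<bullet> (D *v v)" for v
    by (simp add: block_matrix_mult_vec_join vec_join_inner)
  have "psd D"
    using psd sym D_form unfolding psd_def by metis
  have "invertible D"
  proof (rule invertible_if_trivial_kernel)
    fix v assume "D *v v = 0"
    then have "vec_join 0 v \<bullet> (?M *v vec_join (0 :: real^'a) v) = 0" by (simp add: D_form)
    then show "v = 0" using kernel vec_join_eq_0_iff by blast
  qed
  note Dinv = matrix_inv_inverse[OF this]
  have "psd (matrix_inv D)" by (intro psd_matrix_inv \<open>psd D\<close> \<open>invertible D\<close>)
  then have "transpose (B ** matrix_inv D ** C) = B ** matrix_inv D ** C"
    using sym by (simp add: matrix_transpose_mul matrix_mul_assoc psd_def)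
  moreover have "transpose (X - Y) = transpose X - transpose Y" for X Y :: "real^'a^'a"
    by (simp add: transpose_def vec_eq_iff)
  ultimately have symW: "transpose W = W"
    using sym(1) by (simp add: W_def)
  define opt where "opt u = vec_join u (- (matrix_inv D *v (C *v u)))" for u
  have M_opt: "?M *v opt u = vec_join (W *v u) 0" for u
    by (simp add: opt_def block_matrix_mult_vec_join W_def matrix_vector_mult_diff_rdistrib
        matrix_vector_mul_assoc Dinv matrix_mul_assoc matrix_vector_mult_minus)
  have form: "opt u \<bullet> (?M *v opt u) = u \<bullet> (W *v u)" for u
    unfolding M_opt by (simp add: opt_def vec_join_inner)
  show "psd W" using symW psd form unfolding psd_def by metis
  show "u = 0" if "u \<bullet> (W *v u) = 0"
    using kernel[of "opt u"] that form[of u] by (simp add: opt_def vec_join_eq_0_iff)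
qed

text \<open>
  The noise covariance may be singular. Invertibility of the sum is due to the Schur complement
  alone, which is the covariance of the approximation error conditioned on the unknown.
\<close>

lemma psd_inverse_cond_cov:
  assumes "psd See" "psd (block_matrix Szz Szq Sqz Sqq)" "invertible (block_matrix Szz Szq Sqz Sqq)"
  shows "psd (matrix_inv (cond_cov See Szz Szq Sqz Sqq))"
proof -
  define W where "W = Szz - Szq ** matrix_inv Sqq ** Sqz"
  have S: "cond_cov See Szz Szq Sqz Sqq = See + W"
    by (simp add: cond_cov_def W_def)
  have W: "psd W" "\<And>u. u \<bullet> (W *v u) = 0 \<Longrightarrow> u = 0"
    using Schur_complement_pos_def[OF assms(2,3)] by (auto simp: W_def)
  have form: "u \<bullet> ((See + W) *v u) = u \<bullet> (See *v u) + u \<bullet> (W *v u)" for u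
    by (simp add: matrix_vector_mult_add_rdistrib inner_add_right)
  have nonneg: "0 \<le> u \<bullet> (See *v u)" "0 \<le> u \<bullet> (W *v u)" for u
    using assms(1) W(1) by (auto simp: psd_def)
  have "transpose (See + W) = transpose See + transpose W"
    by (simp add: transpose_def vec_eq_iff)
  then have "psd (See + W)"
    using assms(1) W(1) by (auto simp: psd_def form)
  moreover have "invertible (See + W)"
  proof (rule invertible_if_trivial_kernel)
    fix u assume "(See + W) *v u = 0"
    then have "u \<bullet> (W *v u) = 0" using form[of u] nonneg[of u] by simp
    then show "u = 0" by (rule W(2))
  qed
  ultimately show ?thesis unfolding S by (rule psd_matrix_inv)
qed

section \<open>Hellinger distance and normalised densities\<close>

text \<open>
  The Radon--Nikodym derivatives in the Hellinger distance agree with the given densities only almost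
  everywhere, which suffices for the integral. A uniform bound on the difference of the square roots
  is an \<open>L\<^sup>2\<close> bound because the reference measure has mass 1.
\<close>

lemma hellinger_density_le:
  fixes f g :: "'a \<Rightarrow> real"
  assumes "prob_space \<nu>" and f: "f \<in> borel_measurable \<nu>" and g: "g \<in> borel_measurable \<nu>"
    and "\<And>x. 0 \<le> f x" "\<And>x. 0 \<le> g x" and "0 \<le> K"
    and close: "\<And>x. \<bar>sqrt (f x) - sqrt (g x)\<bar> \<le> K"
  shows "hellinger \<nu> (density \<nu> (\<lambda>x. ennreal (f x))) (density \<nu> (\<lambda>x. ennreal (g x))) \<le> K"
proof -
  interpret prob_space \<nu> by fact
  let ?h = "\<lambda>x. (sqrt (enn2real (RN_deriv \<nu> (density \<nu> (\<lambda>x. ennreal (f x))) x))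
    - sqrt (enn2real (RN_deriv \<nu> (density \<nu> (\<lambda>x. ennreal (g x))) x)))\<^sup>2"
  have "AE x in \<nu>. ennreal (f x) = RN_deriv \<nu> (density \<nu> (\<lambda>x. ennreal (f x))) x"
    using f by (intro RN_deriv_unique[OF _ refl]) simp
  moreover have "AE x in \<nu>. ennreal (g x) = RN_deriv \<nu> (density \<nu> (\<lambda>x. ennreal (g x))) x"
    using g by (intro RN_deriv_unique[OF _ refl]) simp
  ultimately have bound: "AE x in \<nu>. ?h x \<le> K\<^sup>2"
  proof eventually_elim
    case (elim x)
    have "?h x = (sqrt (f x) - sqrt (g x))\<^sup>2"
      unfolding elim[symmetric] using assms(4,5) by simp
    also have "\<dots> \<le> K\<^sup>2"
      using close[of x] \<open>0 \<le> K\<close> by (intro abs_le_square_iff[THEN iffD1]) simp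
    finally show ?case .
  qed
  have "integrable \<nu> ?h"
    using bound by (intro integrable_const_bound[where B = "K\<^sup>2"]) auto
  then have "(\<integral>x. ?h x \<partial>\<nu>) \<le> K\<^sup>2"
    using bound by (rule integral_le_const)
  then have "sqrt (\<integral>x. ?h x \<partial>\<nu>) \<le> sqrt (K\<^sup>2)" by (rule real_sqrt_le_mono)
  with \<open>0 \<le> K\<close> show ?thesis by (simp add: hellinger_def)
qed

text \<open>
  The derivative of \<open>s \<mapsto> 1 / sqrt s\<close> is at most \<open>1 / (2 d sqrt d)\<close> in modulus on \<open>[d, \<infinity>)\<close>; the
  proof computes the difference quotient exactly instead.
\<close>

lemma inverse_sqrt_Lipschitz:
  fixes a b d :: real
  assumes "0 < d" "d \<le> a" "d \<le> b"
  shows "\<bar>1 / sqrt a - 1 / sqrt b\<bar> \<le> \<bar>a - b\<bar> / (2 * d * sqrt d)"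
proof -
  have pos: "0 < sqrt d" "sqrt d \<le> sqrt a" "sqrt d \<le> sqrt b" using assms by auto
  have "\<bar>a - b\<bar> = \<bar>sqrt a - sqrt b\<bar> * (sqrt a + sqrt b)"
  proof -
    have "a - b = (sqrt a - sqrt b) * (sqrt a + sqrt b)"
      using assms by (simp add: algebra_simps)
    then show ?thesis using pos by (simp add: abs_mult)
  qed
  moreover have "\<bar>1 / sqrt a - 1 / sqrt b\<bar> = \<bar>sqrt a - sqrt b\<bar> / (sqrt a * sqrt b)"
  proof -
    have "1 / sqrt a - 1 / sqrt b = - (sqrt a - sqrt b) / (sqrt a * sqrt b)"
      using pos by (simp add: field_simps)
    then show ?thesis using pos by (simp add: abs_mult)
  qed
  moreover have "sqrt a + sqrt b \<noteq> 0" using pos by linarith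
  ultimately have eq: "\<bar>1 / sqrt a - 1 / sqrt b\<bar> = \<bar>a - b\<bar> / ((sqrt a * sqrt b) * (sqrt a + sqrt b))"
    by (simp only: nonzero_mult_divide_mult_cancel_right not_False_eq_True)
  have "(sqrt d * sqrt d) * (sqrt d + sqrt d) \<le> (sqrt a * sqrt b) * (sqrt a + sqrt b)"
    using pos by (intro mult_mono add_mono) auto
  then have "2 * d * sqrt d \<le> (sqrt a * sqrt b) * (sqrt a + sqrt b)"
    using assms by (simp add: algebra_simps)
  moreover have "0 < (sqrt a * sqrt b) * (sqrt a + sqrt b) * (2 * d * sqrt d)"
    using pos assms by (intro mult_pos_pos add_pos_pos) auto
  ultimately show ?thesis unfolding eq by (intro divide_left_mono) auto
qed

text \<open>
  The Gaussian factor absorbs the linear growth of the derivative of the exponent, since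
  \<open>|s| / 2 \<le> 1 + s\<^sup>2 / 4 \<le> exp (s\<^sup>2 / 4)\<close>. A Lipschitz constant valid on the whole line is what makes the
  stability estimate insensitive to the size of the forward map.
\<close>

lemma exp_neg_quarter_square_Lipschitz:
  fixes a b :: real
  shows "\<bar>exp (- a\<^sup>2 / 4) - exp (- b\<^sup>2 / 4)\<bar> \<le> \<bar>a - b\<bar>"
proof -
  have "norm (exp (- a\<^sup>2 / 4) - exp (- b\<^sup>2 / 4)) \<le> 1 * norm (a - b)"
  proof (rule field_differentiable_bound[where S = UNIV])
    fix s :: real
    show "((\<lambda>s. exp (- s\<^sup>2 / 4)) has_field_derivative - s / 2 * exp (- s\<^sup>2 / 4)) (at s within UNIV)"
      by (auto intro!: derivative_eq_intros)
    have "0 \<le> (\<bar>s\<bar> / 2 - 1)\<^sup>2" by simp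
    then have "\<bar>s\<bar> / 2 \<le> 1 + s\<^sup>2 / 4" by (simp add: power2_diff power_divide)
    also have "\<dots> \<le> exp (s\<^sup>2 / 4)" by (rule exp_ge_add_one_self)
    finally show "norm (- s / 2 * exp (- s\<^sup>2 / 4)) \<le> 1"
      by (simp add: abs_mult exp_minus field_simps)
  qed auto
  then show ?thesis by simp
qed

section \<open>Stability of the posterior\<close>

lemma borel_measurable_wnorm [measurable]:
  assumes "f \<in> borel_measurable M"
  shows "(\<lambda>x. wnorm A (f x)) \<in> borel_measurable M"
proof -
  have "continuous_on UNIV (wnorm A)"
    unfolding wnorm_def by (intro continuous_intros)
  from borel_measurable_continuous_on[OF this assms] show ?thesis .
qed

text \<open>
  The estimates on \<open>g\<close>, the square root of the likelihood, are global in the data. The bound \<open>r\<close> enters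
  through the lower bound \<open>d\<close> on the evidence, by which the density is normalised: data far from
  the predictions that the prior makes likely have small evidence.
\<close>

lemma hellinger_posterior_Lipschitz:
  fixes \<mu>q :: "(real^3) measure" and F w :: "real^3 \<Rightarrow> real^'k" and S :: "real^'k^'k"
  assumes "prob_space \<mu>q" and F: "F \<in> borel_measurable \<mu>q" and w: "w \<in> borel_measurable \<mu>q"
    and psd: "psd (matrix_inv S)"
  shows "\<exists>M>0. \<forall>m1 m2. max (norm m1) (norm m2) \<le> r \<longrightarrow>
    hellinger \<mu>q (posterior \<mu>q (potential F w S) m1) (posterior \<mu>q (potential F w S) m2)
      \<le> M * norm (m1 - m2)"
proof -
  interpret prob_space \<mu>q by fact
  note [measurable] = F w
  define N where "N = wnorm (matrix_inv S)"
  \<comment> \<open>the square root of the likelihood: hence 4 instead of 2 in the exponent\<close>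
  define g where "g m q = exp (- (N (m - F q - w q))\<^sup>2 / 4)" for m q
  define L where "L = evidence \<mu>q (potential F w S)"
  obtain C where "C > 0" and C: "\<And>v. N v \<le> C * norm v"
    using wnorm_le_norm[of "matrix_inv S"] unfolding N_def by blast
  have N_meas [measurable]: "(\<lambda>q. N (f q)) \<in> borel_measurable \<mu>q" if "f \<in> borel_measurable \<mu>q" for f
    unfolding N_def using that by (rule borel_measurable_wnorm)
  have g_meas [measurable]: "g m \<in> borel_measurable \<mu>q" for m
    unfolding g_def by measurable
  have g_pos: "0 < g m q" and g_le_1: "g m q \<le> 1" for m q
    by (auto simp: g_def)
  have exp_potential: "exp (- potential F w S q m) = (g m q)\<^sup>2" for m q
    using wnorm_squared[OF psd, of "m - F q - w q"]
    by (simp add: potential_def g_def N_def exp_double[symmetric] field_simps)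
  have g2_int: "integrable \<mu>q (\<lambda>q. (g m q)\<^sup>2)" for m
    using g_pos g_le_1 by (intro integrable_const_bound[where B = 1]) (auto simp: abs_square_le_1 less_imp_le)
  have L_eq: "L m = (\<integral>q. (g m q)\<^sup>2 \<partial>\<mu>q)" for m
    by (simp add: L_def evidence_def exp_potential)

  have g_Lipschitz: "\<bar>g m1 q - g m2 q\<bar> \<le> C * norm (m1 - m2)" for m1 m2 q
  proof -
    have "\<bar>g m1 q - g m2 q\<bar> \<le> \<bar>N (m1 - F q - w q) - N (m2 - F q - w q)\<bar>"
      unfolding g_def by (rule exp_neg_quarter_square_Lipschitz)
    also have "\<dots> \<le> N (m1 - m2)"
      using wnorm_reverse_triangle[OF psd, of "m1 - F q - w q" "m2 - F q - w q"]
      by (simp add: N_def)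
    also have "\<dots> \<le> C * norm (m1 - m2)" by (rule C)
    finally show ?thesis .
  qed

  have L_Lipschitz: "\<bar>L m1 - L m2\<bar> \<le> 2 * C * norm (m1 - m2)" for m1 m2
  proof -
    have "\<bar>(g m1 q)\<^sup>2 - (g m2 q)\<^sup>2\<bar> \<le> 2 * C * norm (m1 - m2)" for q
    proof -
      have "\<bar>(g m1 q)\<^sup>2 - (g m2 q)\<^sup>2\<bar> = \<bar>g m1 q - g m2 q\<bar> * (g m1 q + g m2 q)"
        using g_pos[of m1 q] g_pos[of m2 q]
        by (simp add: power2_eq_square square_diff_square_factored abs_mult mult.commute)
      also have "\<dots> \<le> (C * norm (m1 - m2)) * (1 + 1)"
        using g_pos[of m1 q] g_pos[of m2 q] \<open>C > 0\<close>
        by (intro mult_mono add_mono g_Lipschitz g_le_1) auto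
      finally show ?thesis by simp
    qed
    then have "\<bar>\<integral>q. (g m1 q)\<^sup>2 - (g m2 q)\<^sup>2 \<partial>\<mu>q\<bar> \<le> 2 * C * norm (m1 - m2)"
      using g2_int by (intro order_trans[OF integral_abs_bound] integral_le_const) auto
    then show ?thesis using g2_int by (simp add: L_eq)
  qed

  obtain d where "d > 0" and d: "\<And>m. norm m \<le> r \<Longrightarrow> d \<le> L m"
  proof
    \<comment> \<open>a positive lower bound of the likelihood, common to all data of norm at most \<open>r\<close>\<close>
    define h where "h q = exp (- (C * r + N (F q + w q))\<^sup>2 / 2)" for q
    have [measurable]: "h \<in> borel_measurable \<mu>q" unfolding h_def by measurable
    have h_int: "integrable \<mu>q h"
      by (intro integrable_const_bound[where B = 1]) (auto simp: h_def)
    then show "0 < (\<integral>q. h q \<partial>\<mu>q)"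
      by (rule expectation_greater) (simp add: h_def)
    show "(\<integral>q. h q \<partial>\<mu>q) \<le> L m" if "norm m \<le> r" for m
      unfolding L_eq
    proof (intro integral_mono h_int g2_int)
      fix q
      have "N (m - F q - w q) \<le> N m + N (F q + w q)"
        using wnorm_diff_le[OF psd, of m "F q + w q"] by (simp add: N_def diff_diff_eq)
      also have "N m \<le> C * r"
        using C[of m] that \<open>C > 0\<close> by (meson mult_left_mono less_imp_le order_trans)
      finally have "(N (m - F q - w q))\<^sup>2 \<le> (C * r + N (F q + w q))\<^sup>2"
        using psd by (intro power_mono) (auto simp: N_def)
      then show "h q \<le> (g m q)\<^sup>2"
        by (simp add: h_def g_def exp_double[symmetric])
    qed
  qed

  \<comment> \<open>first summand from varying the likelihood, second from varying the normalisation\<close>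
  define M where "M = C / sqrt d + 2 * C / (2 * d * sqrt d)"
  have "M > 0" using \<open>C > 0\<close> \<open>d > 0\<close> by (simp add: M_def add_pos_pos)
  moreover have "hellinger \<mu>q (posterior \<mu>q (potential F w S) m1) (posterior \<mu>q (potential F w S) m2)
      \<le> M * norm (m1 - m2)" if "max (norm m1) (norm m2) \<le> r" for m1 m2
    unfolding posterior_def exp_potential L_def[symmetric]
  proof (rule hellinger_density_le)
    have L: "d \<le> L m1" "d \<le> L m2" using that d by auto
    then have L_pos: "0 < L m1" "0 < L m2" using \<open>d > 0\<close> by auto
    show "0 \<le> 1 / L m1 * (g m1 q)\<^sup>2" "0 \<le> 1 / L m2 * (g m2 q)\<^sup>2" for q
      using L_pos by auto
    show "0 \<le> M * norm (m1 - m2)" using \<open>M > 0\<close> by simp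
    fix q
    have "\<bar>sqrt (1 / L m1 * (g m1 q)\<^sup>2) - sqrt (1 / L m2 * (g m2 q)\<^sup>2)\<bar>
      = \<bar>(g m1 q - g m2 q) * (1 / sqrt (L m1)) + g m2 q * (1 / sqrt (L m1) - 1 / sqrt (L m2))\<bar>"
      using g_pos[of m1 q] g_pos[of m2 q] by (simp add: real_sqrt_mult real_sqrt_divide algebra_simps)
    also have "\<dots> \<le> \<bar>g m1 q - g m2 q\<bar> * (1 / sqrt (L m1)) + g m2 q * \<bar>1 / sqrt (L m1) - 1 / sqrt (L m2)\<bar>"
      using abs_triangle_ineq[of "(g m1 q - g m2 q) * (1 / sqrt (L m1))"
          "g m2 q * (1 / sqrt (L m1) - 1 / sqrt (L m2))"] g_pos[of m2 q] L_pos
      by (simp add: abs_mult)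
    also have "\<dots> \<le> (C * norm (m1 - m2)) * (1 / sqrt d)
        + 1 * ((2 * C * norm (m1 - m2)) / (2 * d * sqrt d))"
    proof (intro add_mono mult_mono g_Lipschitz g_le_1)
      show "1 / sqrt (L m1) \<le> 1 / sqrt d"
        using L \<open>d > 0\<close> L_pos by (intro divide_left_mono) auto
      have "\<bar>1 / sqrt (L m1) - 1 / sqrt (L m2)\<bar> \<le> \<bar>L m1 - L m2\<bar> / (2 * d * sqrt d)"
        by (intro inverse_sqrt_Lipschitz L \<open>d > 0\<close>)
      also have "\<dots> \<le> (2 * C * norm (m1 - m2)) / (2 * d * sqrt d)"
        using \<open>d > 0\<close> by (intro divide_right_mono L_Lipschitz) auto
      finally show "\<bar>1 / sqrt (L m1) - 1 / sqrt (L m2)\<bar> \<le> (2 * C * norm (m1 - m2)) / (2 * d * sqrt d)" .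
    qed (use \<open>C > 0\<close> \<open>d > 0\<close> L_pos in auto)
    also have "\<dots> = M * norm (m1 - m2)" by (simp add: M_def algebra_simps)
    finally show "\<bar>sqrt (1 / L m1 * (g m1 q)\<^sup>2) - sqrt (1 / L m2 * (g m2 q)\<^sup>2)\<bar> \<le> M * norm (m1 - m2)" .
  qed (auto intro: \<open>prob_space \<mu>q\<close>)
  ultimately show ?thesis by blast
qed

section \<open>The point source model\<close>

lemma borel_measurable_vec_lambda:
  fixes f :: "'a \<Rightarrow> 'k::finite \<Rightarrow> real"
  assumes "\<And>i. (\<lambda>x. f x i) \<in> borel_measurable M"
  shows "(\<lambda>x. \<chi> i. f x i) \<in> borel_measurable M"
proof (subst borel_measurable_euclidean_space, rule ballI)
  fix b :: "real^'k" assume "b \<in> Basis"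
  then obtain i where b: "b = axis i 1" by (auto simp: Basis_vec_def)
  show "(\<lambda>x. (\<chi> i. f x i) \<bullet> b) \<in> borel_measurable M"
    unfolding b inner_axis using assms[of i] by simp
qed

text \<open>
  After time \<open>T\<close> the signal is arbitrary, possibly not measurable. As waves arrive after they are
  emitted, only its values up to \<open>T\<close> are used, and there it agrees with a Borel function supported
  on \<open>[0, T]\<close>.
\<close>

lemma borel_measurable_forward:
  assumes zero: "\<And>s. s < 0 \<Longrightarrow> lam s = 0" and cont: "continuous_on {0..T} lam"
    and "c > 0" and t: "\<And>n. t n \<le> T"
  shows "forward lam c x t \<in> borel_measurable borel"
proof -
  define lam' where "lam' s = indicator {0..T} s *\<^sub>R lam s" for s
  have [measurable]: "lam' \<in> borel_measurable borel"
    unfolding lam'_def using cont by (intro borel_measurable_continuous_on_indicator) auto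
  have "lam s = lam' s" if "s \<le> T" for s
    using that zero by (auto simp: lam'_def indicator_def)
  moreover have "t n - norm (x l - q) / c \<le> T" for n l q
    using t[of n] divide_nonneg_pos[OF norm_ge_zero \<open>c > 0\<close>, of "x l - q"] by linarith
  ultimately have "forward lam c x t =
    (\<lambda>q. \<chi> i. lam' (t (snd i) - norm (x (fst i) - q) / c) / (4 * pi * norm (x (fst i) - q)))"
    by (simp add: forward_def fun_eq_iff)
  also have "\<dots> \<in> borel_measurable borel"
    by (intro borel_measurable_vec_lambda) measurable
  finally show ?thesis .
qed

lemma C1_on_Icc_imp_continuous_on: "C1_on_Icc f a b \<Longrightarrow> continuous_on {a..b} f"
  unfolding C1_on_Icc_def by (meson DERIV_continuous_on)

lemma borel_measurable_cond_mean: "cond_mean es zs qs Szq Sqq \<in> borel_measurable borel"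
  unfolding cond_mean_def
  by (intro borel_measurable_continuous_onI continuous_on_add continuous_on_const
      bounded_linear.continuous_on[OF matrix_vector_mul_bounded_linear] continuous_on_diff continuous_on_id)

lemma gaussian_measure_psd: "gaussian_measure \<mu> a S \<Longrightarrow> psd S"
  by (simp add: gaussian_measure_def psd_def)

theorem theorem5:
  fixes \<Omega> D \<Gamma> :: "(real^3) set"
    and c T p :: real
    and J j :: nat
    and lam :: "real \<Rightarrow> real"
    and x :: "'l::finite \<Rightarrow> real^3"
    and t :: "'n::finite \<Rightarrow> real"
    and P :: "'w measure"
    and e \<zeta> :: "'w \<Rightarrow> real^('l \<times> 'n)"
    and Q :: "'w \<Rightarrow> real^3"
    and es zs :: "real^('l \<times> 'n)"
    and qs :: "real^3"
    and See Szz :: "real^('l \<times> 'n)^('l \<times> 'n)"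
    and Szq :: "real^3^('l \<times> 'n)"
    and Sqz :: "real^('l \<times> 'n)^3"
    and Sqq :: "real^3^3"
    and \<mu>q :: "(real^3) measure"
  assumes "bounded_domain \<Omega>" and "simply_connected \<Omega>"
    and "bounded_domain D" and "\<Omega> \<subseteq> D"
    and "\<Gamma> \<subseteq> - closure D"
    and "c > 0" and "T > 2 * diameter \<Omega> / c"
    and "p > 0" and "J > 0" and "T = real J * p"
    and "\<And>s. s < 0 \<Longrightarrow> lam s = 0"
    and "C1_on_Icc lam 0 T" and "periodic_on_Icc lam 0 T p"
    and "1 \<le> j" and "j \<le> J"
    and "\<And>l. x l \<in> \<Gamma>"
    and "\<And>n. t n \<in> {(real j - 1) * p <.. real j * p}"
    and "prob_space P"
    and "gaussian_rv P e es See" and "es = 0"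
    and "gaussian_rv P (\<lambda>\<omega>. vec_join (\<zeta> \<omega>) (Q \<omega>)) (vec_join zs qs) (block_matrix Szz Szq Sqz Sqq)"
    and "invertible (block_matrix Szz Szq Sqz Sqq)"
    and "gaussian_measure \<mu>q qs Sqq"
  shows "let G = potential (forward lam c x t) (cond_mean es zs qs Szq Sqq) (cond_cov See Szz Szq Sqz Sqq);
             \<mu> = posterior \<mu>q G
         in \<forall>r>0. \<exists>M>0. \<forall>m1 m2. max (norm m1) (norm m2) \<le> r \<longrightarrow>
              hellinger \<mu>q (\<mu> m1) (\<mu> m2) \<le> M * norm (m1 - m2)"
proof -
  have "t n \<le> T" for n
  proof -
    have "t n \<le> real j * p" using assms(17)[of n] by auto
    also have "\<dots> \<le> real J * p" using \<open>j \<le> J\<close> \<open>p > 0\<close> by simp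
    finally show ?thesis using \<open>T = real J * p\<close> by simp
  qed
  with assms(11) C1_on_Icc_imp_continuous_on[OF \<open>C1_on_Icc lam 0 T\<close>] \<open>c > 0\<close>
  have F: "forward lam c x t \<in> borel_measurable borel"
    by (rule borel_measurable_forward)
  have prior: "prob_space \<mu>q" "sets \<mu>q = sets borel"
    using \<open>gaussian_measure \<mu>q qs Sqq\<close> by (auto simp: gaussian_measure_def)
  have borel: "borel_measurable \<mu>q = borel_measurable borel"
    by (intro measurable_cong_sets prior) simp
  have "psd (matrix_inv (cond_cov See Szz Szq Sqz Sqq))"
    using assms(19,21,22) by (auto simp: gaussian_rv_def intro: psd_inverse_cond_cov gaussian_measure_psd)
  from hellinger_posterior_Lipschitz[OF prior(1) _ _ this, unfolded borel,
      OF F borel_measurable_cond_mean]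
  show ?thesis by (simp add: Let_def)
qed

end
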